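(* Let $k\ge 2$ be an integer and let $0\le\delta\le 1/2$. Let $\mathsf{AND}_k:\{0,1\}^k\to\{0,1\}$ be the function $\mathsf{AND}_k(z)=z_1\wedge\cdots\wedge z_k$, and for $j\in[k]$ let $\zeta_j$ be the uniform distribution on $I_j=\{z\in\{0,1\}^k : z_j=0\}$, and $\eta=\{\zeta_1,\dots,\zeta_k\}$. Then \[\mathrm{IC}_{\eta,\delta}(\mathsf{AND}_k)\ \ge\ \log_2 e\cdot\bigl(1-2\sqrt{\delta(1-\delta)}\bigr)\cdot\frac{1}{k^2\,4^{k-1}}.\]
   Context: Number-on-the-forehead (NOF) model: $k$ players compute $f:\mathcal Z_1\times\cdots\times\mathcal Z_k\to\{0,1\}$; on input $z=(z_1,\dots,z_k)$, player $j$ sees all of $z$ except $z_j$, i.e. sees $z^{-j}=(z_1,\dots,z_{j-1},z_{j+1},\dots,z_k)$. Players use private random coins and broadcast bits according to a protocol $\Pi$; each bit sent by player $j$ depends only on $z^{-j}$, the transcript so far, and player $j$'s private coins. $\Pi(z)$ denotes the (random) transcript on input $z$, and the output is determined by the transcript. $\Pi$ is a $\delta$-error protocol for $f$ if for every input $z$ the output equals $f(z)$ with probability at least $1-\delta$. For a distribution $\zeta$ on inputs and $\mathbf Z\sim\zeta$, the information cost of $\Pi$ w.r.t. $\zeta$ is the mutual information $I(\mathbf Z;\Pi(\mathbf Z))$ (in bits, logarithms base 2), where the protocol's coins are independent of $\mathbf Z$. For a collection $\eta=\{\zeta_1,\dots,\zeta_k\}$, $\mathrm{IC}_{\eta,\delta}(f)=\min_{\Pi}\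 \frac1k\sum_{j=1}^k I(\mathbf Z_j;\Pi(\mathbf Z_j))$ with $\mathbf Z_j\sim\zeta_j$, the minimum taken over all $\delta$-error randomized NOF protocols $\Pi$ for $f$. *)

theory Defs
  imports "HOL-Probability.Probability"
begin

text \<open>
  The players are the elements of a finite type \<open>'k\<close>, so their number is \<open>CARD('k)\<close>.
  An input is a function \<open>z :: 'k \<Rightarrow> 'a\<close>, where \<open>z j\<close> is written on the forehead of player \<open>j\<close>.
\<close>

text \<open>The private randomness of one player: an unbounded supply of independent fair coin tosses.\<close>

type_synonym coins = "nat \<Rightarrow> bool"

definition coin_measure :: "coins measure" where
  "coin_measure = (\<Pi>\<^sub>M i\<in>UNIV. measure_pmf (bernoulli_pmf (1/2)))"

definition joint_coins :: "('k::finite \<Rightarrow> coins) measure" where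
  "joint_coins = (\<Pi>\<^sub>M j\<in>UNIV. coin_measure)"

text \<open>
  The transcript so far determines who speaks next, where \<open>None\<close> means that the protocol has
  ended. \<open>message P j z t c\<close> is the bit broadcast by player \<open>j\<close> on input \<open>z\<close>, after transcript \<open>t\<close>
  and with private coins \<open>c\<close>; \<open>nof_protocol\<close> below forbids it to depend on \<open>z j\<close>.
\<close>

record ('k, 'a) protocol =
  speaker :: "bool list \<Rightarrow> 'k option"
  message :: "'k \<Rightarrow> ('k \<Rightarrow> 'a) \<Rightarrow> bool list \<Rightarrow> coins \<Rightarrow> bool"
  answer :: "bool list \<Rightarrow> bool"

primrec run :: "('k, 'a) protocol \<Rightarrow> ('k \<Rightarrow> 'a) \<Rightarrow> ('k \<Rightarrow> coins) \<Rightarrow> nat \<Rightarrow> bool list" where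
  "run P z r 0 = []"
| "run P z r (Suc n) =
    (case speaker P (run P z r n) of
       None \<Rightarrow> run P z r n
     | Some j \<Rightarrow> run P z r n @ [message P j z (run P z r n) (r j)])"

definition halts :: "('k, 'a) protocol \<Rightarrow> ('k \<Rightarrow> 'a) \<Rightarrow> ('k \<Rightarrow> coins) \<Rightarrow> bool" where
  "halts P z r \<longleftrightarrow> (\<exists>n. speaker P (run P z r n) = None)"

text \<open>Irrelevant arbitrary value if the run does not halt, which has probability 0 below.\<close>

definition transcript :: "('k, 'a) protocol \<Rightarrow> ('k \<Rightarrow> 'a) \<Rightarrow> ('k \<Rightarrow> coins) \<Rightarrow> bool list" where
  "transcript P z r = run P z r (LEAST n. speaker P (run P z r n) = None)"

definition nof_protocol :: "('k::finite, 'a) protocol \<Rightarrow> bool" where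
  "nof_protocol P \<longleftrightarrow>
     (\<forall>j z z' t c. (\<forall>i. i \<noteq> j \<longrightarrow> z i = z' i) \<longrightarrow> message P j z t c = message P j z' t c) \<and>
     (\<forall>j z t. message P j z t \<in> measurable coin_measure (count_space UNIV)) \<and>
     (\<forall>z. AE r in joint_coins. halts P z r)"

definition computes_with_error ::
    "('k::finite, 'a) protocol \<Rightarrow> real \<Rightarrow> (('k \<Rightarrow> 'a) \<Rightarrow> bool) \<Rightarrow> bool" where
  "computes_with_error P \<delta> f \<longleftrightarrow>
     (\<forall>z. measure joint_coins {r \<in> space joint_coins. answer P (transcript P z r) = f z} \<ge> 1 - \<delta>)"

text \<open>\<open>I(Z; \<Pi>(Z))\<close> in bits, where \<open>Z\<close> has law \<open>\<zeta>\<close> and is independent of the coins.\<close>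

definition information_cost ::
    "('k::finite \<Rightarrow> 'a::finite) pmf \<Rightarrow> ('k, 'a) protocol \<Rightarrow> real" where
  "information_cost \<zeta> P =
     prob_space.mutual_information (measure_pmf \<zeta> \<Otimes>\<^sub>M joint_coins) 2
       (count_space UNIV) (count_space UNIV) fst (\<lambda>(z, r). transcript P z r)"

text \<open>The minimum over all protocols is rendered as an infimum; it need not be attained.\<close>

definition IC ::
    "('k::finite \<Rightarrow> ('k \<Rightarrow> 'a::finite) pmf) \<Rightarrow> real \<Rightarrow> (('k \<Rightarrow> 'a) \<Rightarrow> bool) \<Rightarrow> real" where
  "IC \<eta> \<delta> f =
     (INF P\<in>{P :: ('k, 'a) protocol. nof_protocol P \<and> computes_with_error P \<delta> f}.
        1 / real CARD('k) * (\<Sum>j\<in>UNIV. information_cost (\<eta> j) P))"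

definition AND_fun :: "('k \<Rightarrow> bool) \<Rightarrow> bool" where
  "AND_fun z \<longleftrightarrow> (\<forall>j. z j)"

definition zeta :: "'k::finite \<Rightarrow> ('k \<Rightarrow> bool) pmf" where
  "zeta j = pmf_of_set {z. \<not> z j}"

end

theory Submission
  imports Defs
begin

text \<open>
  Let \<open>p\<^sub>z(t)\<close> be the probability of transcript \<open>t\<close> on input \<open>z\<close>. It factors as \<open>\<Prod>\<^sub>j q\<^sub>j(t, z)\<close> with
  \<open>q\<^sub>j\<close> independent of \<open>z j\<close>, so pairing the inputs that differ only at \<open>j\<close> shows that the products of
  \<open>p\<^sub>z(t)\<close> over the inputs with an odd and with an even number of zeros agree. Thus \<open>p\<close> at the all-ones
  input is determined by the other \<open>p\<^sub>z\<close>, all of which lie on some \<open>I\<^sub>j\<close>. Quantitatively, with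
  \<open>x\<^sub>z = sqrt p\<^sub>z(t)\<close>, the all-ones input \<open>T\<close>, the all-zeros input \<open>F\<close>, and \<open>s\<^sub>z = 1\<close> or \<open>s\<^sub>z = -1\<close> according to
  whether the number of zeros is odd or even,
  \<open>(x\<^sub>T - x\<^sub>F)\<^sup>2 + \<Sum>\<^sub>z s\<^sub>z x\<^sub>z\<^sup>2 \<le> 2 \<Sum>\<^sub>j \<Sum>\<^sub>z\<^sub>,\<^sub>z\<^sub>' (x\<^sub>z - x\<^sub>z\<^sub>')\<^sup>2\<close> with \<open>z, z'\<close> ranging over \<open>I\<^sub>j\<close>.
  Summing over \<open>t\<close> removes the signed sum, and the left-hand side becomes twice the squared Hellinger
  distance of the laws at \<open>T\<close> and \<open>F\<close>, which is large because the answers there differ. The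
  right-hand side is controlled by the information costs through \<open>ln u \<ge> 2 (1 - 1 / sqrt u)\<close>.
\<close>

subsection \<open>The pointwise cut-and-paste inequality\<close>

text \<open>Counting zeros instead of ones puts the all-ones input into the even class for every
  number of players.\<close>

definition odd_zeros :: "('k::finite \<Rightarrow> bool) set" where
  "odd_zeros = {z. odd (card {i. \<not> z i})}"

text \<open>The pairs are ordered, so each unordered pair counts twice, and a pair counts again for
  every further common zero. With \<open>x z = sqrt (p z t)\<close>, the summand for
  \<open>j\<close> is the part that the information cost with respect to \<open>zeta j\<close>
  controls.\<close>

definition energy :: "(('k::finite \<Rightarrow> bool) \<Rightarrow> real) \<Rightarrow> real" where
  "energy x = (\<Sum>j\<in>UNIV. \<Sum>z | \<not> z j. \<Sum>z' | \<not> z' j. (x z - x z')\<^sup>2)"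

lemma flip_odd_zeros:
  fixes z :: "'k::finite \<Rightarrow> bool"
  shows "z(j := \<not> z j) \<in> odd_zeros \<longleftrightarrow> z \<notin> odd_zeros"
proof (cases "z j")
  case True
  have "{i. \<not> (z(j := \<not> z j)) i} = insert j {i. \<not> z i}" using True by auto
  then show ?thesis using True by (simp add: odd_zeros_def)
next
  case False
  have "{i. \<not> z i} = insert j {i. \<not> (z(j := \<not> z j)) i}" using False by auto
  moreover have "j \<notin> {i. \<not> (z(j := \<not> z j)) i}" using False by simp
  ultimately have "card {i. \<not> z i} = Suc (card {i. \<not> (z(j := \<not> z j)) i})"
    by (metis card_insert_disjoint finite)
  then show ?thesis by (simp add: odd_zeros_def)
qed

lemma bij_betw_flip_odd_zeros:
  "bij_betw (\<lambda>z. z(j := \<not> z j)) (odd_zeros :: ('k::finite \<Rightarrow> bool) set) (- odd_zeros)"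
  by (rule bij_betw_byWitness[where f' = "\<lambda>z. z(j := \<not> z j)"]) (auto simp: flip_odd_zeros)

lemma bij_betw_flip_coordinate:
  "bij_betw (\<lambda>z. z(j := \<not> z j)) {z :: 'k \<Rightarrow> bool. \<not> z j} {z. z j}"
  by (rule bij_betw_byWitness[where f' = "\<lambda>z. z(j := \<not> z j)"]) (auto simp: fun_upd_idem)

lemma card_odd_zeros:
  "card (- odd_zeros :: ('k::finite \<Rightarrow> bool) set) = card (odd_zeros :: ('k \<Rightarrow> bool) set)"
  using bij_betw_same_card[OF bij_betw_flip_odd_zeros] by (rule sym)

lemma card_coordinate: "card {z :: 'k::finite \<Rightarrow> bool. z j} = card {z :: 'k \<Rightarrow> bool. \<not> z j}"
  using bij_betw_same_card[OF bij_betw_flip_coordinate] by metis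

lemma card_coordinate_False:
  "card {z :: 'k::finite \<Rightarrow> bool. \<not> z j} = 2 ^ (CARD('k) - 1)"
proof -
  have "card (UNIV :: ('k \<Rightarrow> bool) set) = card {z :: 'k \<Rightarrow> bool. z j} + card {z. \<not> z j}"
    by (subst card_Un_disjoint[symmetric]) (auto intro!: arg_cong[where f = card])
  then have "2 * card {z :: 'k \<Rightarrow> bool. \<not> z j} = 2 ^ CARD('k)"
    by (simp add: card_fun card_coordinate)
  moreover have "CARD('k) = Suc (CARD('k) - 1)" by simp
  ultimately show ?thesis by (metis power_Suc mult_cancel1 zero_neq_numeral)
qed

lemma True_notin_odd_zeros: "(\<lambda>_. True) \<notin> odd_zeros"
  by (simp add: odd_zeros_def)

text \<open>For fixed \<open>j\<close>, flipping coordinate \<open>j\<close> is a bijection between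
  the two classes that preserves \<open>Q j\<close>. The factors with index \<open>j\<close>
  therefore have equal products over both classes, and it remains to exchange the two
  products.\<close>

lemma prod_odd_zeros_eq:
  fixes Q :: "'k::finite \<Rightarrow> ('k \<Rightarrow> bool) \<Rightarrow> 'c::comm_monoid_mult"
  assumes "\<And>j z. Q j (z(j := \<not> z j)) = Q j z"
  shows "(\<Prod>z\<in>odd_zeros. \<Prod>j\<in>UNIV. Q j z) = (\<Prod>z\<in>- odd_zeros. \<Prod>j\<in>UNIV. Q j z)"
proof -
  have "(\<Prod>z\<in>- odd_zeros. Q j z) = (\<Prod>z\<in>odd_zeros. Q j z)" for j
    using prod.reindex_bij_betw[OF bij_betw_flip_odd_zeros, of "Q j" j] assms by simp
  then show ?thesis unfolding prod.swap[of _ UNIV] by simp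
qed

section \<open>Families of pairs that are paid for by the energy\<close>

text \<open>A pair with a common zero \<open>j\<close> occurs in the summand of
  \<open>energy\<close> for \<open>j\<close>. Since \<open>R\<close> is a set of ordered pairs, none
  of them is charged twice.\<close>

lemma sum_le_energy:
  fixes x :: "('k::finite \<Rightarrow> bool) \<Rightarrow> real"
  assumes "\<And>z z'. (z, z') \<in> R \<Longrightarrow> \<exists>j. \<not> z j \<and> \<not> z' j"
  shows "(\<Sum>(z, z')\<in>R. (x z - x z')\<^sup>2) \<le> energy x"
proof -
  have "(\<Sum>(z, z')\<in>R. (x z - x z')\<^sup>2)
      \<le> (\<Sum>(z, z')\<in>R. \<Sum>j\<in>UNIV. if \<not> z j \<and> \<not> z' j then (x z - x z')\<^sup>2 else 0)"
  proof (rule sum_mono, clarify)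
    fix z z' assume "(z, z') \<in> R"
    then obtain j where "\<not> z j \<and> \<not> z' j" using assms by blast
    then show "(x z - x z')\<^sup>2 \<le> (\<Sum>j\<in>UNIV. if \<not> z j \<and> \<not> z' j then (x z - x z')\<^sup>2 else 0)"
      using member_le_sum[of j UNIV "\<lambda>j. if \<not> z j \<and> \<not> z' j then (x z - x z')\<^sup>2 else 0"] by simp
  qed
  also have "\<dots> \<le> (\<Sum>(z, z')\<in>UNIV. \<Sum>j\<in>UNIV. if \<not> z j \<and> \<not> z' j then (x z - x z')\<^sup>2 else 0)"
    by (rule sum_mono2) (auto intro!: sum_nonneg)
  also have "\<dots> = (\<Sum>j\<in>UNIV. \<Sum>(z, z')\<in>UNIV \<times> UNIV. if \<not> z j \<and> \<not> z' j then (x z - x z')\<^sup>2 else 0)"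
    unfolding case_prod_unfold UNIV_Times_UNIV by (rule sum.swap)
  also have "\<dots> = (\<Sum>j\<in>UNIV. \<Sum>(z, z')\<in>{z. \<not> z j} \<times> {z'. \<not> z' j}. (x z - x z')\<^sup>2)"
    by (intro sum.cong refl sum.mono_neutral_cong_right) auto
  also have "\<dots> = energy x"
    by (simp add: energy_def sum.cartesian_product)
  finally show ?thesis .
qed

text \<open>The all-zeros input shares a zero with every input except all-ones, so it can be the
  centre of a star. The factor 2 comes from the two orders of each pair.\<close>

lemma star_le_energy:
  fixes x :: "('k::finite \<Rightarrow> bool) \<Rightarrow> real" and w :: "'k \<Rightarrow> bool"
  assumes w: "w = (\<lambda>_. False)"
  shows "2 * (\<Sum>z\<in>- {\<lambda>_. True, w}. (x z - x w)\<^sup>2) \<le> energy x"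
proof -
  define A where "A = - {\<lambda>_. True, w}"
  have "(\<Sum>(z, z')\<in>A \<times> {w} \<union> {w} \<times> A. (x z - x z')\<^sup>2) \<le> energy x"
    by (rule sum_le_energy) (auto simp: A_def w fun_eq_iff)
  moreover have "(\<Sum>(z, z')\<in>A \<times> {w} \<union> {w} \<times> A. (x z - x z')\<^sup>2)
      = (\<Sum>z\<in>A. (x z - x w)\<^sup>2) + (\<Sum>z\<in>A. (x w - x z)\<^sup>2)"
    by (subst sum.union_disjoint) (auto simp: A_def sum.cartesian_product[symmetric])
  ultimately show ?thesis by (simp add: A_def power2_commute[of "x w"])
qed

text \<open>A second star, centred at \<open>b\<close> within the half-cube where \<open>z j\<close>
  is false, avoids \<open>w\<close>. It is disjoint from the first star, so one copy of the energy
  pays for both.\<close>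

lemma double_star_le_energy:
  fixes x :: "('k::finite \<Rightarrow> bool) \<Rightarrow> real" and w b :: "'k \<Rightarrow> bool"
  assumes w: "w = (\<lambda>_. False)" and b: "\<not> b j" "b \<noteq> w"
  shows "2 * (\<Sum>z\<in>- {\<lambda>_. True, w}. (x z - x w)\<^sup>2) + 2 * (\<Sum>z\<in>{z. \<not> z j} - {w, b}. (x z - x b)\<^sup>2)
    \<le> energy x"
proof -
  define A where "A = - {\<lambda>_. True, w}"
  define B where "B = {z. \<not> z j} - {w, b}"
  have "(\<Sum>(z, z')\<in>(A \<times> {w} \<union> {w} \<times> A) \<union> (B \<times> {b} \<union> {b} \<times> B). (x z - x z')\<^sup>2) \<le> energy x"
    by (rule sum_le_energy) (use b in \<open>auto simp: A_def B_def w fun_eq_iff\<close>)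
  moreover have "(A \<times> {w} \<union> {w} \<times> A) \<inter> (B \<times> {b} \<union> {b} \<times> B) = {}"
    using b by (auto simp: A_def B_def)
  moreover have "(\<Sum>(z, z')\<in>A \<times> {w} \<union> {w} \<times> A. (x z - x z')\<^sup>2)
      = (\<Sum>z\<in>A. (x z - x w)\<^sup>2) + (\<Sum>z\<in>A. (x w - x z)\<^sup>2)"
    by (subst sum.union_disjoint) (auto simp: A_def sum.cartesian_product[symmetric])
  moreover have "(\<Sum>(z, z')\<in>B \<times> {b} \<union> {b} \<times> B. (x z - x z')\<^sup>2)
      = (\<Sum>z\<in>B. (x z - x b)\<^sup>2) + (\<Sum>z\<in>B. (x b - x z)\<^sup>2)"
    by (subst sum.union_disjoint) (auto simp: B_def sum.cartesian_product[symmetric])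
  ultimately show ?thesis
    by (simp add: A_def B_def sum.union_disjoint power2_commute[of "x w"] power2_commute[of "x b"])
qed

section \<open>Scalar inequalities behind the pointwise bound\<close>

text \<open>The right-hand side minus the left-hand side has derivative \<open>2 * (3 * b - 1) * (b - 1) / b\<close>.\<close>

lemma ln_ge_quadratic:
  fixes b :: real
  assumes "1/4 \<le> b"
  shows "(b\<^sup>2 - 1) - 2 * ln b \<le> 4 * (b - 1)\<^sup>2"
proof -
  define g where "g = (\<lambda>b::real. 4 * (b - 1)\<^sup>2 - ((b\<^sup>2 - 1) - 2 * ln b))"
  \<comment> \<open>The existential form matches the premises of the monotonicity rules, with
    \<open>P\<close> standing for the sign condition on the derivative.\<close>
  have D: "\<exists>d. (g has_real_derivative d) (at t) \<and> P d"
    if "t > 0" "P ((6 * t - 2) * (t - 1) / t)" for t P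
  proof -
    have "(g has_real_derivative 8 * (t - 1) - (2 * t - 2 / t)) (at t)"
      unfolding g_def using that(1) by (auto intro!: derivative_eq_intros)
    also have "8 * (t - 1) - (2 * t - 2 / t) = (6 * t - 2) * (t - 1) / t"
      using that(1) by (simp add: field_simps)
    finally show ?thesis using that(2) by blast
  qed
  \<comment> \<open>The derivative of \<open>g\<close> changes sign at 1/3 and at 1, so the minimum
    over the range is at 1/4 or at 1, and \<open>g 1 = 0\<close>.\<close>
  consider "b \<ge> 1" | "1/3 \<le> b" "b \<le> 1" | "b \<le> 1/3" by linarith
  then have "g b \<ge> 0"
  proof cases
    case 1
    have "g 1 \<le> g b"
      by (intro DERIV_nonneg_imp_nondecreasing[OF 1] D divide_nonneg_pos mult_nonneg_nonneg) auto
    then show ?thesis by (simp add: g_def)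
  next
    case 2
    have "g 1 \<le> g b"
      by (intro DERIV_nonpos_imp_nonincreasing[OF 2(2)] D divide_nonpos_pos mult_nonneg_nonpos)
        (use 2 in auto)
    then show ?thesis by (simp add: g_def)
  next
    case 3
    have "g (1/4) \<le> g b"
      by (intro DERIV_nonneg_imp_nondecreasing[OF assms] D divide_nonneg_pos mult_nonpos_nonpos)
        (use 3 in auto)
    \<comment> \<open>At the left end \<open>g (1/4) = 51/16 - 4 * ln 2\<close>, so any bound on
      \<open>ln 2\<close> below 51/64 suffices.\<close>
    moreover have "ln (1/4 :: real) = - 2 * ln 2"
      using ln_realpow[of "2::real" 2] by (simp add: ln_div)
    then have "g (1/4) \<ge> 0"
      using ln2_le_25_over_36 by (simp add: g_def power2_eq_square)
    ultimately show ?thesis by simp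
  qed
  then show ?thesis by (simp add: g_def)
qed

text \<open>Completing the square shows the slack in both cases. Next to the factor 4, the constant
  1/3 is the least possible, with equality at \<open>x = 4/3\<close>. The absolute value covers both
  parities of an input.\<close>

lemma square_deviation_bound:
  fixes x :: real
  assumes "0 \<le> x"
  shows "\<bar>x\<^sup>2 - 1\<bar> \<le> 1/3 + 4 * (x - 1)\<^sup>2"
proof (cases "1 \<le> x")
  case True
  then have "\<bar>x\<^sup>2 - 1\<bar> = x\<^sup>2 - 1" by simp
  moreover have "1/3 + 4 * (x - 1)\<^sup>2 - (x\<^sup>2 - 1) = 3 * (x - 4/3)\<^sup>2"
    by (simp add: power2_eq_square algebra_simps)
  ultimately show ?thesis using zero_le_power2[of "x - 4/3"] by linarith
next
  case False
  then have "\<bar>x\<^sup>2 - 1\<bar> = 1 - x\<^sup>2" using assms power_le_one[of x 2] by simp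
  moreover have "1/3 + 4 * (x - 1)\<^sup>2 - (1 - x\<^sup>2) = 5 * (x - 4/5)\<^sup>2 + 2/15"
    by (simp add: power2_eq_square algebra_simps)
  ultimately show ?thesis using zero_le_power2[of "x - 4/5"] by linarith
qed

text \<open>A value cannot be close to both 1 and \<open>b\<close>, so the two squares together
  leave a surplus. The offset -1/3 is what cancels the +1/3 of \<open>square_deviation_bound\<close>
  when the two half-cubes are matched.\<close>

lemma square_deviation_bound_two_points:
  fixes x b :: real
  assumes "0 \<le> x" "0 \<le> b" "b \<le> 1/4"
  shows "\<bar>x\<^sup>2 - 1\<bar> \<le> - (1/3) + 4 * (x - 1)\<^sup>2 + 4 * (x - b)\<^sup>2"
proof -
  consider "1 \<le> x" | "1/4 \<le> x" "x \<le> 1" | "x \<le> 1/4" by linarith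
  then show ?thesis
  proof cases
    case 1
    have "(3/4)\<^sup>2 \<le> (x - b)\<^sup>2" using 1 assms by (intro power_mono) auto
    then show ?thesis using square_deviation_bound[OF assms(1)]
      by (simp add: power2_eq_square)
  next
    case 2
    \<comment> \<open>In this range \<open>b = 1/4\<close> is the worst case.\<close>
    have "(x - 1/4)\<^sup>2 \<le> (x - b)\<^sup>2" using 2 assms by (intro power_mono) auto
    moreover have "\<bar>x\<^sup>2 - 1\<bar> = 1 - x\<^sup>2" using 2 power_le_one[of x 2] by simp
    moreover have "- (1/3) + 4 * (x - 1)\<^sup>2 + 4 * (x - 1/4)\<^sup>2 - (1 - x\<^sup>2) = 9 * (x - 5/9)\<^sup>2 + 5/36"
      by (simp add: power2_eq_square algebra_simps)
    ultimately show ?thesis using zero_le_power2[of "x - 5/9"] by linarith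
  next
    case 3
    have "(3/4)\<^sup>2 \<le> (1 - x)\<^sup>2" using 3 by (intro power_mono) auto
    then have "9/16 \<le> (x - 1)\<^sup>2" by (simp add: power2_commute[of x 1] power_divide)
    moreover have "\<bar>x\<^sup>2 - 1\<bar> \<le> 1" using 3 assms power_le_one[of x 2] by simp
    ultimately show ?thesis using zero_le_power2[of "x - b"] by linarith
  qed
qed

text \<open>
  If no odd \<open>x z\<close> is small, the product relation expresses \<open>ln (x T)\<close> through the other values and the
  comparison is term by term. A small odd \<open>x b\<close> makes its pairs with the half of the cube on which
  \<open>z j\<close> is false so expensive that they pay for the other half.
\<close>

lemma cut_and_paste_normalized:
  fixes x :: "('k::finite \<Rightarrow> bool) \<Rightarrow> real"
  assumes nonneg: "\<And>z. 0 \<le> x z"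
    and prod_eq: "(\<Prod>z\<in>odd_zeros. x z) = (\<Prod>z\<in>- odd_zeros. x z)"
    and one: "x (\<lambda>_. False) = 1"
  shows "(x (\<lambda>_. True) - 1)\<^sup>2 + (\<Sum>z\<in>odd_zeros. (x z)\<^sup>2) - (\<Sum>z\<in>- odd_zeros. (x z)\<^sup>2) \<le> 2 * energy x"
proof -
  define T W :: "'k \<Rightarrow> bool" where "T = (\<lambda>_. True)" and "W = (\<lambda>_. False)"
  define Ev :: "('k \<Rightarrow> bool) set" where "Ev = - odd_zeros - {T}"
  have T: "T \<notin> odd_zeros" unfolding T_def by (rule True_notin_odd_zeros)
  have TW: "T \<noteq> W" by (auto simp: T_def W_def fun_eq_iff)
  have Ev: "- odd_zeros = insert T Ev" "T \<notin> Ev" using T by (auto simp: Ev_def)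
  have UNIV_split: "- {T} = odd_zeros \<union> Ev" "odd_zeros \<inter> Ev = {}" using T by (auto simp: Ev_def)
  have card: "real (card (odd_zeros :: ('k \<Rightarrow> bool) set)) = 1 + real (card Ev)"
    using card_odd_zeros[where 'k = 'k] Ev by simp
  have xW: "x W = 1" using one by (simp add: W_def)
  have star: "2 * (\<Sum>z\<in>- {T}. (x z - 1)\<^sup>2) \<le> energy x"
  proof -
    have "(\<Sum>z\<in>- {T}. (x z - 1)\<^sup>2) = (\<Sum>z\<in>- {T, W}. (x z - 1)\<^sup>2)"
      by (rule sum.mono_neutral_right) (auto simp: xW)
    then show ?thesis using star_le_energy[OF refl, of x] one by (simp add: T_def W_def)
  qed
  have split: "(\<Sum>z\<in>- {T}. f z) = (\<Sum>z\<in>odd_zeros. f z) + (\<Sum>z\<in>Ev. f z)" for f :: "_ \<Rightarrow> real"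
    unfolding UNIV_split(1) by (rule sum.union_disjoint) (use UNIV_split(2) in auto)
  \<comment> \<open>The square of \<open>x T\<close> cancels. The odd class has one element more
    than \<open>Ev\<close>, so subtracting 1 from every summand changes the difference of sums by 1,
    which turns \<open>1 - 2 * x T\<close> into \<open>2 * (1 - x T)\<close>.\<close>
  have lhs: "(x T - 1)\<^sup>2 + (\<Sum>z\<in>odd_zeros. (x z)\<^sup>2) - (\<Sum>z\<in>- odd_zeros. (x z)\<^sup>2)
      = 2 * (1 - x T) + (\<Sum>z\<in>odd_zeros. (x z)\<^sup>2 - 1) - (\<Sum>z\<in>Ev. (x z)\<^sup>2 - 1)"
    using Ev card by (simp add: sum_subtractf power2_eq_square algebra_simps)
  show ?thesis
  proof (cases "\<forall>z\<in>odd_zeros. 1/4 \<le> x z")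
    case True
    have "(\<Prod>z\<in>odd_zeros. x z) > 0" using True by (intro prod_pos) force
    then have prod_pos: "(\<Prod>z\<in>- odd_zeros. x z) > 0" using prod_eq by simp
    have pos: "0 < x z" if "z \<in> - odd_zeros" for z
    proof -
      have "x z \<noteq> 0" using prod_pos that by (auto simp: less_le)
      then show ?thesis using nonneg[of z] by simp
    qed
    have "(\<Sum>z\<in>odd_zeros. ln (x z)) = ln (\<Prod>z\<in>odd_zeros. x z)"
      by (rule ln_prod[symmetric]) (use True in force)+
    also have "\<dots> = (\<Sum>z\<in>- odd_zeros. ln (x z))"
      unfolding prod_eq by (rule ln_prod) (use pos in force)+
    finally have "ln (x T) = (\<Sum>z\<in>odd_zeros. ln (x z)) - (\<Sum>z\<in>Ev. ln (x z))"
      using Ev by simp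
    \<comment> \<open>This bounds \<open>2 * (1 - x T)\<close> by \<open>- 2 * ln (x T)\<close>,
      which the product relation distributes over the remaining inputs. Each even term is then
      harmless by \<open>ln u \<le> u - 1\<close> at \<open>u = (x z)\<^sup>2\<close>.\<close>
    moreover have "ln (x T) \<le> x T - 1" using pos[of T] T by (simp add: ln_le_minus_one)
    ultimately have "2 * (1 - x T) + (\<Sum>z\<in>odd_zeros. (x z)\<^sup>2 - 1) - (\<Sum>z\<in>Ev. (x z)\<^sup>2 - 1)
        \<le> (\<Sum>z\<in>odd_zeros. (x z)\<^sup>2 - 1 - 2 * ln (x z)) - (\<Sum>z\<in>Ev. (x z)\<^sup>2 - 1 - 2 * ln (x z))"
      by (simp add: sum_subtractf sum_distrib_left[symmetric])
    also have "\<dots> \<le> (\<Sum>z\<in>odd_zeros. 4 * (x z - 1)\<^sup>2) - (\<Sum>z\<in>Ev. 0)"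
    proof (intro diff_mono sum_mono)
      fix z :: "'k \<Rightarrow> bool"
      show "(x z)\<^sup>2 - 1 - 2 * ln (x z) \<le> 4 * (x z - 1)\<^sup>2" if "z \<in> odd_zeros"
        using ln_ge_quadratic[of "x z"] that True by simp
      show "0 \<le> (x z)\<^sup>2 - 1 - 2 * ln (x z)" if "z \<in> Ev"
      proof -
        have "0 < x z" using that pos by (simp add: Ev_def)
        then show ?thesis using ln_le_minus_one[of "(x z)\<^sup>2"] by (simp add: ln_realpow)
      qed
    qed
    also have "\<dots> \<le> 4 * (\<Sum>z\<in>- {T}. (x z - 1)\<^sup>2)"
      unfolding split by (simp add: sum_distrib_left sum_nonneg)
    finally show ?thesis using star lhs by (simp add: T_def)
  next
    case False
    then obtain b where b: "b \<in> odd_zeros" "x b < 1/4" by force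
    then have "b \<noteq> T" using T by auto
    then obtain j where j: "\<not> b j" by (auto simp: T_def fun_eq_iff)
    have "b \<noteq> W" using b xW by auto
    define I where "I = {z :: 'k \<Rightarrow> bool. \<not> z j} - {W, b}"
    define J where "J = {z :: 'k \<Rightarrow> bool. z j} - {T}"
    have part: "- {T} = insert W (insert b (I \<union> J))" "W \<notin> insert b (I \<union> J)" "b \<notin> I \<union> J" "I \<inter> J = {}"
      using j \<open>b \<noteq> W\<close> TW by (auto simp: I_def J_def W_def T_def fun_eq_iff)
    have sum_part: "(\<Sum>z\<in>- {T}. f z) = f W + f b + (\<Sum>z\<in>I. f z) + (\<Sum>z\<in>J. f z)" for f :: "_ \<Rightarrow> real"
      unfolding part(1) using part(2-4) by (simp add: sum.union_disjoint)
    \<comment> \<open>The half-cubes have equal size; \<open>I\<close> lacks two points and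
      \<open>J\<close> only one. The offsets of 1/3 therefore cancel except for one.\<close>
    have cardIJ: "real (card J) = real (card I) + 1"
    proof -
      have "{z :: 'k \<Rightarrow> bool. \<not> z j} = insert W (insert b I)" "W \<notin> insert b I" "b \<notin> I"
        using j \<open>b \<noteq> W\<close> by (auto simp: I_def W_def)
      moreover have "{z :: 'k \<Rightarrow> bool. z j} = insert T J" "T \<notin> J" by (auto simp: J_def T_def)
      ultimately have "card {z :: 'k \<Rightarrow> bool. \<not> z j} = Suc (Suc (card I))"
        "card {z :: 'k \<Rightarrow> bool. z j} = Suc (card J)" by simp_all
      then show ?thesis using card_coordinate[of j] by simp
    qed
    define s :: "('k \<Rightarrow> bool) \<Rightarrow> real" where "s z = (if z \<in> odd_zeros then 1 else - 1)" for z
    \<comment> \<open>In this case \<open>x T\<close> is estimated only by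
      \<open>0 \<le> x T\<close>.\<close>
    have "2 * (1 - x T) + (\<Sum>z\<in>odd_zeros. (x z)\<^sup>2 - 1) - (\<Sum>z\<in>Ev. (x z)\<^sup>2 - 1)
        \<le> 2 + (\<Sum>z\<in>- {T}. s z * ((x z)\<^sup>2 - 1))"
    proof -
      have "(\<Sum>z\<in>odd_zeros. s z * ((x z)\<^sup>2 - 1)) = (\<Sum>z\<in>odd_zeros. (x z)\<^sup>2 - 1)"
        by (rule sum.cong) (auto simp: s_def)
      moreover have "(\<Sum>z\<in>Ev. s z * ((x z)\<^sup>2 - 1)) = - (\<Sum>z\<in>Ev. (x z)\<^sup>2 - 1)"
        unfolding sum_negf[symmetric] by (rule sum.cong) (auto simp: s_def Ev_def)
      ultimately show ?thesis using nonneg[of T] by (simp add: split)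
    qed
    also have "(\<Sum>z\<in>- {T}. s z * ((x z)\<^sup>2 - 1))
        \<le> (x b)\<^sup>2 - 1 + (\<Sum>z\<in>I. - (1/3) + 4 * (x z - 1)\<^sup>2 + 4 * (x z - x b)\<^sup>2) + (\<Sum>z\<in>J. 1/3 + 4 * (x z - 1)\<^sup>2)"
    proof -
      have s_le: "s z * a \<le> \<bar>a\<bar>" for z a by (simp add: s_def abs_if)
      have "(\<Sum>z\<in>I. s z * ((x z)\<^sup>2 - 1)) \<le> (\<Sum>z\<in>I. - (1/3) + 4 * (x z - 1)\<^sup>2 + 4 * (x z - x b)\<^sup>2)"
        by (intro sum_mono order_trans[OF s_le] square_deviation_bound_two_points)
          (use nonneg b in \<open>auto intro: less_imp_le\<close>)
      moreover have "(\<Sum>z\<in>J. s z * ((x z)\<^sup>2 - 1)) \<le> (\<Sum>z\<in>J. 1/3 + 4 * (x z - 1)\<^sup>2)"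
        by (intro sum_mono order_trans[OF s_le] square_deviation_bound nonneg)
      ultimately show ?thesis using b unfolding sum_part by (simp add: xW s_def)
    qed
    also have "2 + \<dots> \<le> 4 * (\<Sum>z\<in>- {T}. (x z - 1)\<^sup>2) + 4 * (\<Sum>z\<in>I. (x z - x b)\<^sup>2)"
    proof -
      \<comment> \<open>The constant in \<open>4/3 + (x b)\<^sup>2\<close> is 2 from the all-ones
        input, -1 from the term of \<open>b\<close>, and 1/3 from the surplus element of
        \<open>J\<close>. The pair of \<open>b\<close> with the all-zeros input pays for it.\<close>
      have "(x b)\<^sup>2 \<le> (1/4)\<^sup>2" using b nonneg by (intro power_mono) auto
      moreover have "(3/4)\<^sup>2 \<le> (1 - x b)\<^sup>2" using b by (intro power_mono) auto
      ultimately have "4/3 + (x b)\<^sup>2 \<le> 4 * (x b - 1)\<^sup>2"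
        by (simp add: power2_eq_square algebra_simps)
      then show ?thesis unfolding sum_part using cardIJ
        by (simp add: xW sum.distrib sum_subtractf sum_distrib_left[symmetric] add_divide_distrib)
    qed
    also have "\<dots> \<le> 2 * energy x"
    proof -
      have "(\<Sum>z\<in>- {T}. (x z - 1)\<^sup>2) = (\<Sum>z\<in>- {T, W}. (x z - 1)\<^sup>2)"
        by (rule sum.mono_neutral_right) (auto simp: xW)
      then show ?thesis
        using double_star_le_energy[of W b j x] j \<open>b \<noteq> W\<close> xW by (simp add: T_def W_def I_def)
    qed
    finally show ?thesis using lhs by (simp add: T_def)
  qed
qed

text \<open>Both sides are homogeneous of degree 2, and scaling preserves the product relation
  because the classes have equal size, so the value at all-zeros may be scaled to 1. If that value
  is 0, the star centred there already bounds all the squares except the one at all-ones, which the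
  even sum absorbs.\<close>

lemma cut_and_paste:
  fixes x :: "('k::finite \<Rightarrow> bool) \<Rightarrow> real"
  assumes nonneg: "\<And>z. 0 \<le> x z"
    and prod_eq: "(\<Prod>z\<in>odd_zeros. x z) = (\<Prod>z\<in>- odd_zeros. x z)"
  shows "(x (\<lambda>_. True) - x (\<lambda>_. False))\<^sup>2 + (\<Sum>z\<in>odd_zeros. (x z)\<^sup>2) - (\<Sum>z\<in>- odd_zeros. (x z)\<^sup>2)
    \<le> 2 * energy x"
proof (cases "x (\<lambda>_. False) = 0")
  case True
  define T W :: "'k \<Rightarrow> bool" where "T = (\<lambda>_. True)" and "W = (\<lambda>_. False)"
  have "(x T)\<^sup>2 \<le> (\<Sum>z\<in>- odd_zeros. (x z)\<^sup>2)"
    by (rule member_le_sum) (auto simp: T_def True_notin_odd_zeros)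
  moreover have "(\<Sum>z\<in>odd_zeros. (x z)\<^sup>2) \<le> (\<Sum>z\<in>- {T}. (x z)\<^sup>2)"
    by (rule sum_mono2) (auto simp: T_def True_notin_odd_zeros)
  moreover have "(\<Sum>z\<in>- {T}. (x z)\<^sup>2) = (\<Sum>z\<in>- {T, W}. (x z)\<^sup>2)"
    using True by (intro sum.mono_neutral_right) (auto simp: W_def)
  moreover have "2 * (\<Sum>z\<in>- {T, W}. (x z)\<^sup>2) \<le> energy x"
    using star_le_energy[OF refl, of x] True by (simp add: T_def W_def)
  moreover have "0 \<le> energy x" by (simp add: energy_def sum_nonneg)
  ultimately show ?thesis using True unfolding T_def by simp
next
  case False
  define c where "c = x (\<lambda>_. False)"
  have c: "c > 0" using False nonneg[of "\<lambda>_. False"] by (simp add: c_def)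
  define y where "y = (\<lambda>z. x z / c)"
  have "(\<Prod>z\<in>odd_zeros. y z) = (\<Prod>z\<in>- odd_zeros. y z)"
    using prod_eq by (simp add: y_def prod_dividef card_odd_zeros)
  then have "(y (\<lambda>_. True) - 1)\<^sup>2 + (\<Sum>z\<in>odd_zeros. (y z)\<^sup>2) - (\<Sum>z\<in>- odd_zeros. (y z)\<^sup>2) \<le> 2 * energy y"
    using c nonneg by (intro cut_and_paste_normalized) (auto simp: y_def c_def)
  moreover have "x z = c * y z" for z using c by (simp add: y_def)
  moreover have "(c * a - c * b)\<^sup>2 = c\<^sup>2 * (a - b)\<^sup>2" for a b
    by (simp add: power2_eq_square algebra_simps)
  then have "energy (\<lambda>z. c * y z) = c\<^sup>2 * energy y"
    by (simp add: energy_def sum_distrib_left)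
  then have "energy x = c\<^sup>2 * energy y" using \<open>\<And>z. x z = c * y z\<close> by presburger
  moreover have "(x (\<lambda>_. True) - x (\<lambda>_. False))\<^sup>2 = c\<^sup>2 * (y (\<lambda>_. True) - 1)\<^sup>2"
    using c by (simp add: y_def c_def power2_eq_square field_simps)
  ultimately show ?thesis
    using mult_left_mono[of "(y (\<lambda>_. True) - 1)\<^sup>2 + (\<Sum>z\<in>odd_zeros. (y z)\<^sup>2)
        - (\<Sum>z\<in>- odd_zeros. (y z)\<^sup>2)" "2 * energy y" "c\<^sup>2"]
    by (simp add: power_mult_distrib sum_distrib_left[symmetric] algebra_simps)
qed

subsection \<open>The law of the transcript\<close>

lemma prob_space_coin_measure: "prob_space coin_measure"
  unfolding coin_measure_def by (intro prob_space_PiM measure_pmf.prob_space_axioms)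

lemma prob_space_joint_coins: "prob_space (joint_coins :: ('k::finite \<Rightarrow> coins) measure)"
  unfolding joint_coins_def by (intro prob_space_PiM prob_space_coin_measure)

lemma space_coin_measure [simp]: "space coin_measure = UNIV"
  by (simp add: coin_measure_def space_PiM)

lemma space_joint_coins [simp]: "space joint_coins = UNIV"
  by (simp add: joint_coins_def space_PiM)

lemma nof_protocolD:
  assumes "nof_protocol P"
  shows nof_protocol_message_cong: "(\<And>i. i \<noteq> j \<Longrightarrow> z i = z' i) \<Longrightarrow> message P j z t c = message P j z' t c"
    and nof_protocol_measurable: "message P j z t \<in> coin_measure \<rightarrow>\<^sub>M count_space UNIV"
    and nof_protocol_halts: "AE r in joint_coins. halts P z r"
  using assms unfolding nof_protocol_def by blast+

lemma measurable_run:
  fixes P :: "('k::finite, 'a) protocol"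
  assumes "nof_protocol P"
  shows "(\<lambda>r. run P z r n) \<in> joint_coins \<rightarrow>\<^sub>M count_space UNIV"
proof (induction n)
  case (Suc n)
  have "(\<lambda>r. case speaker P t of None \<Rightarrow> t | Some j \<Rightarrow> t @ [message P j z t (r j)])
      \<in> joint_coins \<rightarrow>\<^sub>M count_space UNIV" for t
  proof (cases "speaker P t")
    case (Some j)
    have "(\<lambda>r. r j) \<in> joint_coins \<rightarrow>\<^sub>M coin_measure"
      unfolding joint_coins_def by (rule measurable_component_singleton) simp
    from measurable_compose[OF this nof_protocol_measurable[OF assms]]
    have "(\<lambda>r. message P j z t (r j)) \<in> joint_coins \<rightarrow>\<^sub>M count_space UNIV" .
    then have "(\<lambda>r. t @ [message P j z t (r j)]) \<in> joint_coins \<rightarrow>\<^sub>M count_space UNIV"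
      by (rule measurable_compose) simp
    then show ?thesis using Some by simp
  qed simp
  from measurable_compose_countable[where
      f = "\<lambda>t r. case speaker P t of None \<Rightarrow> t | Some j \<Rightarrow> t @ [message P j z t (r j)]", OF this Suc]
  show ?case by simp
qed simp

lemma measurable_transcript:
  fixes P :: "('k::finite, 'a) protocol"
  assumes "nof_protocol P"
  shows "transcript P z \<in> joint_coins \<rightarrow>\<^sub>M count_space UNIV"
proof -
  have "(\<lambda>r. speaker P (run P z r n) = None) \<in> joint_coins \<rightarrow>\<^sub>M count_space UNIV" for n
    by (rule measurable_compose[OF measurable_run[OF assms]]) simp
  then have L: "(\<lambda>r. LEAST n. speaker P (run P z r n) = None) \<in> joint_coins \<rightarrow>\<^sub>M count_space UNIV"
    by (rule measurable_Least)
  from measurable_compose_countable[where f = "\<lambda>n r. run P z r n", OF measurable_run[OF assms] L]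
  show ?thesis by (simp add: transcript_def[abs_def])
qed

section \<open>Product structure of the event that a given transcript occurs\<close>

text \<open>This constrains the coins of player \<open>j\<close> alone: positions where another
  player speaks are ignored.\<close>

definition consistent :: "('k, 'a) protocol \<Rightarrow> 'k \<Rightarrow> ('k \<Rightarrow> 'a) \<Rightarrow> bool list \<Rightarrow> coins \<Rightarrow> bool" where
  "consistent P j z t c \<longleftrightarrow>
    (\<forall>i<length t. speaker P (take i t) = Some j \<longrightarrow> message P j z (take i t) c = t ! i)"

text \<open>These are the leaves of the protocol tree; they depend neither on the input nor on the
  coins.\<close>

definition complete_transcript :: "('k, 'a) protocol \<Rightarrow> bool list \<Rightarrow> bool" where
  "complete_transcript P t \<longleftrightarrow> speaker P t = None \<and> (\<forall>i<length t. speaker P (take i t) \<noteq> None)"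

lemma run_consistent:
  assumes "complete_transcript P t" "\<And>j. consistent P j z t (r j)" "i \<le> length t"
  shows "run P z r i = take i t"
  using assms(3)
proof (induction i)
  case (Suc i)
  then obtain j where j: "speaker P (take i t) = Some j"
    using assms(1) by (force simp: complete_transcript_def)
  then have "message P j z (take i t) (r j) = t ! i"
    using assms(2)[of j] Suc.prems by (simp add: consistent_def)
  then show ?case using Suc j by (simp add: take_Suc_conv_app_nth)
qed simp

text \<open>Until the run halts, every round appends exactly one bit, so round numbers and
  transcript lengths agree.\<close>

lemma run_before_halt:
  assumes "\<And>i. i < n \<Longrightarrow> speaker P (run P z r i) \<noteq> None" "i \<le> n"
  shows "length (run P z r i) = i" "run P z r i = take i (run P z r n)"
proof -
  have len: "length (run P z r i) = i" if "i \<le> n" for i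
    using that
  proof (induction i)
    case (Suc i)
    then show ?case using assms(1)[of i] by (auto split: option.split)
  qed simp
  then show "length (run P z r i) = i" using assms(2) .
  have "i \<le> m \<Longrightarrow> m \<le> n \<Longrightarrow> run P z r i = take i (run P z r m)" for m
  proof (induction m)
    case (Suc m)
    show ?case
    proof (cases "i = Suc m")
      case True
      then show ?thesis using len[of i] Suc.prems by simp
    next
      case False
      then have "run P z r i = take i (run P z r m)" "i \<le> length (run P z r m)"
        using Suc len[of m] by auto
      then show ?thesis by (auto split: option.split)
    qed
  qed simp
  then show "run P z r i = take i (run P z r n)" using assms(2) by blast
qed

text \<open>For a fixed leaf, the event is a conjunction of one condition per player on that
  player's own coins. The conjunct \<open>halts P z r\<close> excludes the arbitrary value that
  \<open>transcript\<close> takes on infinite runs.\<close>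

lemma transcript_eq_iff:
  "halts P z r \<and> transcript P z r = t \<longleftrightarrow> complete_transcript P t \<and> (\<forall>j. consistent P j z t (r j))"
proof (intro iffI; elim conjE)
  assume "halts P z r" and t: "transcript P z r = t"
  define n where "n = (LEAST n. speaker P (run P z r n) = None)"
  have n: "speaker P (run P z r n) = None"
    using \<open>halts P z r\<close> unfolding halts_def n_def by (rule LeastI_ex)
  have less: "speaker P (run P z r i) \<noteq> None" if "i < n" for i
    using not_less_Least that unfolding n_def by blast
  have run: "run P z r n = t" using t by (simp add: transcript_def n_def)
  have len: "length t = n" using run_before_halt(1)[of n P z r n] less run by simp
  have take: "run P z r i = take i t" if "i \<le> n" for i
    using run_before_halt(2)[of n P z r i] less run that by simp
  have "complete_transcript P t" using n less run take len by (auto simp: complete_transcript_def)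
  moreover have "consistent P j z t (r j)" for j
    unfolding consistent_def
  proof (intro allI impI)
    fix i assume i: "i < length t" "speaker P (take i t) = Some j"
    then have "take (Suc i) t = take i t @ [message P j z (take i t) (r j)]"
      using take[of i] take[of "Suc i"] len by simp
    then show "message P j z (take i t) (r j) = t ! i"
      using i(1) by (simp add: take_Suc_conv_app_nth)
  qed
  ultimately show "complete_transcript P t \<and> (\<forall>j. consistent P j z t (r j))" by blast
next
  assume t: "complete_transcript P t" and c: "\<forall>j. consistent P j z t (r j)"
  have run: "run P z r i = take i t" if "i \<le> length t" for i
    using run_consistent[OF t _ that] c by blast
  have halt: "speaker P (run P z r (length t)) = None"
    using t run by (simp add: complete_transcript_def)
  have "(LEAST n. speaker P (run P z r n) = None) = length t"
  proof (rule Least_equality)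
    show "speaker P (run P z r (length t)) = None" by (rule halt)
  next
    fix m assume "speaker P (run P z r m) = None"
    then show "length t \<le> m"
      using t run[of m] by (auto simp: complete_transcript_def not_less[symmetric])
  qed
  then have "transcript P z r = t" using run by (simp add: transcript_def)
  then show "halts P z r \<and> transcript P z r = t" using halt by (auto simp: halts_def)
qed

definition transcript_law :: "('k::finite, 'a) protocol \<Rightarrow> ('k \<Rightarrow> 'a) \<Rightarrow> bool list pmf" where
  "transcript_law P z = Abs_pmf (distr joint_coins (count_space UNIV) (transcript P z))"

text \<open>There are countably many transcripts, so the law is carried by its atoms and is a
  legitimate argument of \<open>Abs_pmf\<close>.\<close>

lemma measure_pmf_transcript_law:
  fixes P :: "('k::finite, 'a) protocol"
  assumes "nof_protocol P"
  shows "measure_pmf (transcript_law P z) = distr joint_coins (count_space UNIV) (transcript P z)"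
proof -
  interpret J: prob_space "joint_coins :: ('k \<Rightarrow> coins) measure" by (rule prob_space_joint_coins)
  let ?D = "distr joint_coins (count_space UNIV) (transcript P z)"
  interpret D: prob_space ?D
    by (rule J.prob_space_distr[OF measurable_transcript[OF assms]])
  have "AE t in ?D. measure ?D {t} \<noteq> 0"
    by (subst D.AE_support_countable) (auto intro!: exI[of _ UNIV])
  then show ?thesis
    unfolding transcript_law_def by (intro Abs_pmf_inverse) (simp add: D.prob_space_axioms)
qed

lemma measure_transcript_law:
  fixes P :: "('k::finite, 'a) protocol"
  assumes "nof_protocol P"
  shows "measure (transcript_law P z) A = measure joint_coins {r. transcript P z r \<in> A}"
  unfolding measure_pmf_transcript_law[OF assms]
  by (subst measure_distr[OF measurable_transcript[OF assms]]) (auto simp: vimage_def)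

text \<open>The event is a box in the product of the coin spaces, so independence of the private
  coins turns it into a product over players. The factor of player \<open>j\<close> uses
  \<open>z\<close> only through the messages of \<open>j\<close>.\<close>

lemma pmf_transcript_law:
  fixes P :: "('k::finite, 'a) protocol"
  assumes "nof_protocol P"
  shows "pmf (transcript_law P z) t =
    of_bool (complete_transcript P t) * (\<Prod>j\<in>UNIV. measure coin_measure {c. consistent P j z t c})"
proof -
  interpret J: prob_space "joint_coins :: ('k \<Rightarrow> coins) measure" by (rule prob_space_joint_coins)
  interpret C: finite_product_prob_space "\<lambda>_ :: 'k. coin_measure" UNIV
    by (intro finite_product_prob_space.intro product_prob_space.intro product_sigma_finite.intro
        product_prob_space_axioms.intro finite_product_sigma_finite.intro
        finite_product_sigma_finite_axioms.intro finite prob_space_imp_sigma_finite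
        prob_space_coin_measure)
  have sets: "{c. consistent P j z t c} \<in> sets coin_measure" for j
  proof -
    have [measurable]: "message P j z t' \<in> coin_measure \<rightarrow>\<^sub>M count_space UNIV" for t'
      by (rule nof_protocol_measurable[OF assms])
    have "Measurable.pred coin_measure (consistent P j z t)"
      unfolding consistent_def[abs_def] by measurable
    then show ?thesis by (simp add: pred_def)
  qed
  have "pmf (transcript_law P z) t = measure joint_coins {r. transcript P z r = t}"
    by (simp add: pmf.rep_eq measure_transcript_law[OF assms])
  \<comment> \<open>Almost sure halting allows the conjunct \<open>halts P z r\<close> to be added
    to the event.\<close>
  also have "\<dots> = measure joint_coins {r. complete_transcript P t \<and> (\<forall>j. consistent P j z t (r j))}"
  proof (rule J.finite_measure_eq_AE)
    show "AE r in joint_coins. r \<in> {r. transcript P z r = t} \<longleftrightarrow>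
        r \<in> {r. complete_transcript P t \<and> (\<forall>j. consistent P j z t (r j))}"
      using nof_protocol_halts[OF assms, of z]
      by eventually_elim (simp add: transcript_eq_iff[symmetric])
    show "{r. transcript P z r = t} \<in> sets joint_coins"
      using measurable_sets[OF measurable_transcript[OF assms], of "{t}" z] by (simp add: vimage_def)
    have "(\<Pi>\<^sub>E j\<in>UNIV. {c. consistent P j z t c}) \<in> sets joint_coins"
      unfolding joint_coins_def by (rule sets_PiM_I_finite) (auto intro: sets)
    then show "{r. complete_transcript P t \<and> (\<forall>j. consistent P j z t (r j))} \<in> sets joint_coins"
      by (cases "complete_transcript P t") (simp_all add: PiE_UNIV_domain Pi_def)
  qed
  also have "\<dots> = of_bool (complete_transcript P t) * measure joint_coins (\<Pi>\<^sub>E j\<in>UNIV. {c. consistent P j z t c})"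
    by (simp add: PiE_UNIV_domain Pi_def)
  also have "measure joint_coins (\<Pi>\<^sub>E j\<in>UNIV. {c. consistent P j z t c})
      = (\<Prod>j\<in>UNIV. measure coin_measure {c. consistent P j z t c})"
    unfolding joint_coins_def by (rule C.prob_times) (rule sets)
  finally show ?thesis .
qed

text \<open>The forehead rule makes the factor of player \<open>j\<close> invariant under flipping
  \<open>z j\<close>, which is the hypothesis of \<open>prod_odd_zeros_eq\<close>.\<close>

lemma transcript_law_cut_and_paste:
  fixes P :: "('k::finite, bool) protocol"
  assumes "nof_protocol P"
  shows "(\<Prod>z\<in>odd_zeros. pmf (transcript_law P z) t) = (\<Prod>z\<in>- odd_zeros. pmf (transcript_law P z) t)"
proof (cases "complete_transcript P t")
  case True
  have "consistent P j (z(j := \<not> z j)) t c = consistent P j z t c" for j z c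
    using nof_protocol_message_cong[OF assms, of j "z(j := \<not> z j)" z] by (simp add: consistent_def)
  then show ?thesis
    using prod_odd_zeros_eq[of "\<lambda>j z. measure coin_measure {c. consistent P j z t c}"] True
    by (simp add: pmf_transcript_law[OF assms])
next
  case False
  \<comment> \<open>Off the leaves all factors are 0. Both classes must be seen to be nonempty,
    since an empty product would be 1.\<close>
  have "(\<lambda>_. True) \<in> - (odd_zeros :: ('k \<Rightarrow> bool) set)" by (simp add: True_notin_odd_zeros)
  moreover have "card (odd_zeros :: ('k \<Rightarrow> bool) set) \<noteq> 0"
    using card_odd_zeros[where 'k = 'k] calculation by (metis card_eq_0_iff empty_iff finite)
  ultimately show ?thesis
    using False by (simp add: pmf_transcript_law[OF assms] card_odd_zeros power_0_left)
qed

subsection \<open>Mutual information and Hellinger distance\<close>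

text \<open>Translates the measure-theoretic mutual information into the discrete formula, the
  quotient being the joint mass over the product of the marginals. Coins enter only through the
  conditional laws \<open>\<pi> z\<close>.\<close>

lemma mutual_information_kernel:
  fixes \<zeta> :: "'a::finite pmf" and \<pi> :: "'a \<Rightarrow> 'b::countable pmf"
  assumes J: "prob_space J"
    and meas: "\<And>z. T z \<in> J \<rightarrow>\<^sub>M count_space UNIV"
    and law: "\<And>z. measure_pmf (\<pi> z) = distr J (count_space UNIV) (T z)"
  shows "prob_space.mutual_information (measure_pmf \<zeta> \<Otimes>\<^sub>M J) 2
      (count_space UNIV) (count_space UNIV) fst (\<lambda>(z, r). T z r)
    = (\<integral>(z, t). pmf \<zeta> z * pmf (\<pi> z) t *
        log 2 (pmf \<zeta> z * pmf (\<pi> z) t / (pmf \<zeta> z * pmf (bind_pmf \<zeta> \<pi>) t)) \<partial>count_space UNIV)"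
proof -
  let ?M = "measure_pmf \<zeta> \<Otimes>\<^sub>M J"
  let ?C = "count_space (UNIV :: 'a set) \<Otimes>\<^sub>M count_space (UNIV :: 'b set)"
  let ?XY = "\<lambda>x. (fst x, case x of (z, r) \<Rightarrow> T z r)"
  interpret J: prob_space J by (rule J)
  interpret PP: pair_prob_space "measure_pmf \<zeta>" J ..
  interpret information_space ?M 2
    by (intro information_space.intro information_space_axioms.intro PP.prob_space_axioms) simp
  have C: "?C = count_space UNIV" by (simp add: pair_measure_countable)
  define jp where "jp = bind_pmf \<zeta> (\<lambda>z. map_pmf (Pair z) (\<pi> z))"
  have pmf_jp: "pmf jp (z, t) = pmf \<zeta> z * pmf (\<pi> z) t" for z t
  proof -
    have "pmf (map_pmf (Pair y) (\<pi> y)) (z, t) = (if y = z then pmf (\<pi> z) t else 0)" for y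
      by (auto simp: pmf_map_inj' inj_on_def pmf_eq_0_set_pmf)
    then show ?thesis
      unfolding jp_def pmf_bind
      by (subst integral_measure_pmf_real[of UNIV]) (simp_all add: if_distrib[of "\<lambda>a. a * _"] cong: if_cong)
  qed
  have T: "(\<lambda>(z, r). T z r) \<in> ?M \<rightarrow>\<^sub>M count_space UNIV"
  proof -
    have "(\<lambda>(z, r). T z r) \<in> count_space UNIV \<Otimes>\<^sub>M J \<rightarrow>\<^sub>M count_space UNIV"
      by (rule measurable_pair_measure_countable1) (auto intro: meas)
    then show ?thesis by (simp cong: measurable_cong_sets sets_pair_measure_cong)
  qed
  have fst: "fst \<in> ?M \<rightarrow>\<^sub>M count_space UNIV"
    using measurable_fst[of "measure_pmf \<zeta>" J] by (simp cong: measurable_cong_sets)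
  have XY: "?XY \<in> ?M \<rightarrow>\<^sub>M ?C"
    using fst T by (rule measurable_Pair)
  have joint: "distr ?M ?C ?XY = measure_pmf jp"
  \<comment> \<open>Both spaces are countable, so comparing singletons suffices; their preimages are
    rectangles in the input and the coins.\<close>
  proof (rule measure_eqI_countable[where A = UNIV])
    fix zt :: "'a \<times> 'b"
    obtain z t where zt: "zt = (z, t)" by (cases zt)
    have "emeasure (distr ?M ?C ?XY) {zt} = emeasure ?M ({z} \<times> (T z -` {t} \<inter> space J))"
    proof (subst emeasure_distr[OF XY])
      show "{zt} \<in> sets ?C" unfolding C by simp
      show "emeasure ?M (?XY -` {zt} \<inter> space ?M) = emeasure ?M ({z} \<times> (T z -` {t} \<inter> space J))"
        by (rule arg_cong[where f = "emeasure ?M"]) (auto simp: zt space_pair_measure)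
    qed
    also have "\<dots> = emeasure (measure_pmf \<zeta>) {z} * emeasure J (T z -` {t} \<inter> space J)"
      by (rule J.emeasure_pair_measure_Times) (auto intro: measurable_sets[OF meas])
    also have "emeasure J (T z -` {t} \<inter> space J) = emeasure (measure_pmf (\<pi> z)) {t}"
      using meas by (simp add: law emeasure_distr)
    finally show "emeasure (distr ?M ?C ?XY) {zt} = emeasure (measure_pmf jp) {zt}"
      by (simp add: zt emeasure_pmf_single pmf_jp ennreal_mult)
  qed (simp_all add: C)
  have DX: "distributed ?M (count_space UNIV) fst (\<lambda>z. ennreal (pmf \<zeta> z))"
  proof -
    have "distr ?M (count_space UNIV) fst = distr (distr ?M ?C ?XY) (count_space UNIV) fst"
      using XY by (subst distr_distr) (auto simp: comp_def C)
    also have "\<dots> = measure_pmf (map_pmf fst jp)" by (simp add: joint map_pmf_rep_eq)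
    also have "map_pmf fst jp = \<zeta>" by (simp add: jp_def map_bind_pmf pmf.map_comp comp_def bind_return_pmf')
    finally show ?thesis using fst by (simp add: distributed_def measure_pmf_eq_density)
  qed
  have DY: "distributed ?M (count_space UNIV) (\<lambda>(z, r). T z r) (\<lambda>t. ennreal (pmf (bind_pmf \<zeta> \<pi>) t))"
  proof -
    have "distr ?M (count_space UNIV) (\<lambda>(z, r). T z r) = distr (distr ?M ?C ?XY) (count_space UNIV) snd"
      using XY by (subst distr_distr) (auto simp: comp_def C)
    also have "\<dots> = measure_pmf (map_pmf snd jp)" by (simp add: joint map_pmf_rep_eq)
    also have "map_pmf snd jp = bind_pmf \<zeta> \<pi>" by (simp add: jp_def map_bind_pmf pmf.map_comp comp_def)
    finally show ?thesis using T by (simp add: distributed_def measure_pmf_eq_density)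
  qed
  have DXY: "distributed ?M ?C ?XY (\<lambda>x. ennreal (pmf jp x))"
    using XY joint by (simp add: distributed_def measure_pmf_eq_density C)
  show ?thesis
    by (subst mutual_information_distr[OF _ _ DX _ DY _ DXY])
      (simp_all add: sigma_finite_measure_count_space_countable C pmf_jp case_prod_unfold
        flip: pmf_jp)
qed

section \<open>From relative entropy to pairwise Hellinger distances\<close>

text \<open>The lower bound is \<open>ln u \<le> u - 1\<close> at \<open>u = sqrt (m / p)\<close>.
  The hypothesis \<open>p \<le> c * m\<close> forces \<open>m > 0\<close> wherever
  \<open>p > 0\<close>, and gives the upper bound, which serves integrability.\<close>

lemma relative_entropy_term_bounds:
  fixes p m c :: real
  assumes "0 \<le> p" "0 \<le> m" "p \<le> c * m" "1 \<le> c"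
  shows "2 * log 2 (exp 1) * (p - sqrt (p * m)) \<le> p * log 2 (p / m)"
    and "p * log 2 (p / m) \<le> p * log 2 c"
proof -
  have "2 * log 2 (exp 1) * (p - sqrt (p * m)) \<le> p * log 2 (p / m) \<and> p * log 2 (p / m) \<le> p * log 2 c"
  proof (cases "p = 0")
    case False
    then have p: "0 < p" using assms by simp
    then have m: "0 < m" using assms by (cases "m = 0") auto
    have "ln (sqrt (m / p)) \<le> sqrt (m / p) - 1" using p m by (intro ln_le_minus_one) simp
    then have "2 * (1 - sqrt (m / p)) \<le> ln (p / m)" using p m by (simp add: ln_sqrt ln_div)
    then have "p * (2 * (1 - sqrt (m / p))) \<le> p * ln (p / m)" using p by (intro mult_left_mono) auto
    moreover have "p * sqrt (m / p) = sqrt (p * m)"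
      using p m by (simp add: real_sqrt_divide real_sqrt_mult real_div_sqrt field_simps)
    ultimately have "2 * (p - sqrt (p * m)) \<le> p * ln (p / m)" by (simp add: algebra_simps)
    then have "2 * (p - sqrt (p * m)) / ln 2 \<le> p * ln (p / m) / ln 2"
      by (intro divide_right_mono) auto
    moreover have "log 2 (p / m) \<le> log 2 c"
      using p m assms by (subst log_le_cancel_iff) (auto simp: field_simps)
    then have "p * log 2 (p / m) \<le> p * log 2 c" using p by (intro mult_left_mono) auto
    ultimately show ?thesis by (simp add: log_def)
  qed simp
  then show "2 * log 2 (exp 1) * (p - sqrt (p * m)) \<le> p * log 2 (p / m)"
    and "p * log 2 (p / m) \<le> p * log 2 c" by blast+
qed

text \<open>The left side is \<open>2 * card S\<close> times the squared deviation from the mean,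
  and the mean minimizes the squared deviation over all centres \<open>c\<close>.\<close>

lemma sum_pairwise_squares_le:
  fixes x :: "'a \<Rightarrow> real"
  shows "(\<Sum>z\<in>S. \<Sum>z'\<in>S. (x z - x z')\<^sup>2) \<le> 2 * real (card S) * (\<Sum>z\<in>S. (x z - c)\<^sup>2)"
proof -
  have "(\<Sum>z\<in>S. \<Sum>z'\<in>S. (x z - x z')\<^sup>2) = 2 * real (card S) * (\<Sum>z\<in>S. (x z)\<^sup>2) - 2 * (\<Sum>z\<in>S. x z)\<^sup>2"
    by (simp add: power2_diff sum.distrib sum_subtractf sum_distrib_left[symmetric]
        sum_distrib_right[symmetric] power2_eq_square[of "sum x S"] mult.assoc)
  also have "\<dots> = 2 * real (card S) * (\<Sum>z\<in>S. (x z - c)\<^sup>2) - 2 * ((\<Sum>z\<in>S. x z) - card S * c)\<^sup>2"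
    by (simp add: power2_diff sum.distrib sum_subtractf sum_distrib_left[symmetric]
        sum_distrib_right[symmetric] algebra_simps power2_eq_square[of c] power2_eq_square[of "real (card S)"])
  also have "\<dots> \<le> 2 * real (card S) * (\<Sum>z\<in>S. (x z - c)\<^sup>2)" by simp
  finally show ?thesis .
qed

lemma integrable_sqrt_mult_pmf:
  "integrable (count_space UNIV) (\<lambda>t. sqrt (pmf p t * pmf q t))"
proof (rule Bochner_Integration.integrable_bound)
  show "integrable (count_space UNIV) (\<lambda>t. pmf p t + pmf q t)"
    by (intro Bochner_Integration.integrable_add integrable_pmf)
  show "AE t in count_space UNIV. norm (sqrt (pmf p t * pmf q t)) \<le> norm (pmf p t + pmf q t)"
    using arith_geo_mean_sqrt[OF pmf_nonneg pmf_nonneg, of p _ q]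
    by (intro AE_I2) (simp add: order_trans[OF arith_geo_mean_sqrt] add_nonneg_nonneg)
qed simp

lemma integrable_sqrt_diff_pmf:
  "integrable (count_space UNIV) (\<lambda>t. (sqrt (pmf p t) - sqrt (pmf q t))\<^sup>2)"
proof -
  have "(sqrt (pmf p t) - sqrt (pmf q t))\<^sup>2 = pmf p t + pmf q t - 2 * sqrt (pmf p t * pmf q t)" for t
    by (simp add: power2_diff real_sqrt_mult)
  then show ?thesis
    by (simp only:) (intro Bochner_Integration.integrable_diff Bochner_Integration.integrable_add
        integrable_mult_right integrable_pmf integrable_sqrt_mult_pmf)
qed

text \<open>The mutual information is the average over \<open>S\<close> of the relative entropies of
  \<open>\<pi> z\<close> to the mixture, each at least \<open>log 2 (exp 1)\<close> times the sum of
  the squared differences of square roots. Passing from the mixture as centre to pairs costs the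
  factor \<open>2 * card S\<close>.\<close>

lemma uniform_mutual_information_ge:
  fixes S :: "'a::finite set" and \<pi> :: "'a \<Rightarrow> 'b::countable pmf"
  assumes S: "S \<noteq> {}" and J: "prob_space J"
    and meas: "\<And>z. T z \<in> J \<rightarrow>\<^sub>M count_space UNIV"
    and law: "\<And>z. measure_pmf (\<pi> z) = distr J (count_space UNIV) (T z)"
  shows "log 2 (exp 1) / (2 * (card S)\<^sup>2) *
      (\<integral>t. (\<Sum>z\<in>S. \<Sum>z'\<in>S. (sqrt (pmf (\<pi> z) t) - sqrt (pmf (\<pi> z') t))\<^sup>2) \<partial>count_space UNIV)
    \<le> prob_space.mutual_information (measure_pmf (pmf_of_set S) \<Otimes>\<^sub>M J) 2
      (count_space UNIV) (count_space UNIV) fst (\<lambda>(z, r). T z r)"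
proof -
  define n where "n = real (card S)"
  define p where "p = (\<lambda>z. pmf (\<pi> z))"
  define \<mu> where "\<mu> = bind_pmf (pmf_of_set S) \<pi>"
  define m where "m = pmf \<mu>"
  define L where "L = log 2 (exp 1)"
  define f where "f z t = (if z \<in> S then p z t * log 2 (p z t / m t) / n else 0)" for z t
  have n: "1 \<le> n" using S by (simp add: n_def Suc_le_eq card_gt_0_iff)
  have L: "0 \<le> L" by (simp add: L_def)
  have nonneg: "0 \<le> p z t" "0 \<le> m t" for z t by (simp_all add: p_def m_def)
  have m: "m t = (\<Sum>z\<in>S. p z t) / n" for t
    using S by (simp add: m_def \<mu>_def pmf_bind integral_pmf_of_set p_def n_def)
  have p_le: "p z t \<le> n * m t" if "z \<in> S" for z t
    using member_le_sum[of z S "\<lambda>z. p z t"] that nonneg n by (simp add: m)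
  note bounds = relative_entropy_term_bounds[OF nonneg p_le n, folded L_def]
  \<comment> \<open>An integrable majorant. The lower side combines the entropy bound with the
    inequality of arithmetic and geometric means.\<close>
  have abs_f: "\<bar>f z t\<bar> \<le> ((L + log 2 n) * p z t + L * m t) / n * of_bool (z \<in> S)" for z t
  proof (cases "z \<in> S")
    case True
    have "2 * sqrt (p z t * m t) \<le> p z t + m t"
      using arith_geo_mean_sqrt[OF nonneg, of z t t] by simp
    then have "L * (2 * sqrt (p z t * m t)) \<le> L * (p z t + m t)" using L by (rule mult_left_mono)
    then have "- (L * m t) \<le> p z t * log 2 (p z t / m t) - L * p z t"
      using bounds(1)[OF True, of t] by (simp add: algebra_simps)
    moreover have "0 \<le> L * p z t" "0 \<le> L * m t" "0 \<le> log 2 n * p z t" using L n nonneg by simp_all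
    ultimately have "\<bar>p z t * log 2 (p z t / m t)\<bar> \<le> (L + log 2 n) * p z t + L * m t"
      using bounds(2)[OF True, of t] by (simp add: algebra_simps)
    then show ?thesis using True n by (simp add: f_def abs_mult divide_right_mono)
  qed (simp add: f_def)
  have int_f: "integrable (count_space UNIV) (f z)" for z
  proof (rule Bochner_Integration.integrable_bound)
    show "integrable (count_space UNIV) (\<lambda>t. ((L + log 2 n) * p z t + L * m t) / n * of_bool (z \<in> S))"
      unfolding p_def m_def by (intro integrable_mult_left integrable_divide
        Bochner_Integration.integrable_add integrable_mult_right integrable_pmf)
    show "AE t in count_space UNIV. norm (f z t)
        \<le> norm (((L + log 2 n) * p z t + L * m t) / n * of_bool (z \<in> S))"
      using order_trans[OF abs_f abs_ge_self] by (intro AE_I2) (simp only: real_norm_def)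
  qed simp
  have C: "count_space (UNIV :: 'a set) \<Otimes>\<^sub>M count_space (UNIV :: 'b set) = count_space UNIV"
    by (simp add: pair_measure_countable)
  interpret pair_sigma_finite "count_space (UNIV :: 'a set)" "count_space (UNIV :: 'b set)"
    by (intro pair_sigma_finite.intro sigma_finite_measure_count_space_countable) auto
  have int_f2: "integrable (count_space UNIV) (\<lambda>(z, t). f z t)"
  proof -
    have "integrable (count_space UNIV \<Otimes>\<^sub>M count_space UNIV) (\<lambda>(z, t). f z t)"
      by (rule Fubini_integrable) (auto simp: C int_f integrable_count_space)
    then show ?thesis by (simp add: C)
  qed
  have "(\<integral>(z, t). f z t \<partial>count_space UNIV) = (\<Sum>z\<in>UNIV. \<integral>t. f z t \<partial>count_space UNIV)"
    using integral_fst'[of "\<lambda>(z, t). f z t"] int_f2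
    by (simp add: C lebesgue_integral_count_space_finite)
  also have "\<dots> = (\<integral>t. (\<Sum>z\<in>UNIV. f z t) \<partial>count_space UNIV)"
    by (rule Bochner_Integration.integral_sum[symmetric]) (rule int_f)
  also have "\<dots> \<ge> (\<integral>t. L / (2 * n\<^sup>2) * (\<Sum>z\<in>S. \<Sum>z'\<in>S. (sqrt (p z t) - sqrt (p z' t))\<^sup>2) \<partial>count_space UNIV)"
  proof (rule integral_mono)
    show "integrable (count_space UNIV) (\<lambda>t. L / (2 * n\<^sup>2) *
        (\<Sum>z\<in>S. \<Sum>z'\<in>S. (sqrt (p z t) - sqrt (p z' t))\<^sup>2))"
      unfolding p_def by (intro integrable_mult_right Bochner_Integration.integrable_sum
        integrable_sqrt_diff_pmf)
    show "integrable (count_space UNIV) (\<lambda>t. \<Sum>z\<in>UNIV. f z t)"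
      by (intro Bochner_Integration.integrable_sum int_f)
    fix t
    have "(\<Sum>z\<in>S. \<Sum>z'\<in>S. (sqrt (p z t) - sqrt (p z' t))\<^sup>2)
        \<le> 2 * n * (\<Sum>z\<in>S. (sqrt (p z t) - sqrt (m t))\<^sup>2)"
      unfolding n_def by (rule sum_pairwise_squares_le)
    \<comment> \<open>Single terms differ by \<open>p z t - m t\<close>; these differences sum to 0
      over \<open>S\<close> because \<open>m t\<close> is the average, so the identity holds already
      for each \<open>t\<close>.\<close>
    also have "(\<Sum>z\<in>S. (sqrt (p z t) - sqrt (m t))\<^sup>2) = (\<Sum>z\<in>S. 2 * (p z t - sqrt (p z t * m t)))"
    proof -
      have "(\<Sum>z\<in>S. p z t - m t) = 0" using n by (simp add: sum_subtractf m n_def)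
      moreover have "(sqrt (p z t) - sqrt (m t))\<^sup>2
          = 2 * (p z t - sqrt (p z t * m t)) - (p z t - m t)" for z
        using nonneg by (simp add: power2_diff real_sqrt_mult)
      ultimately show ?thesis by (simp only: sum_subtractf)
    qed
    finally have "L / (2 * n\<^sup>2) * (\<Sum>z\<in>S. \<Sum>z'\<in>S. (sqrt (p z t) - sqrt (p z' t))\<^sup>2)
        \<le> L / (2 * n\<^sup>2) * (2 * n * (\<Sum>z\<in>S. 2 * (p z t - sqrt (p z t * m t))))"
      using L by (intro mult_left_mono) auto
    also have "\<dots> = (\<Sum>z\<in>S. (2 * L * (p z t - sqrt (p z t * m t))) / n)"
      unfolding sum_distrib_left using n
      by (intro sum.cong refl) (simp add: power2_eq_square field_simps)
    also have "\<dots> \<le> (\<Sum>z\<in>S. f z t)"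
      using bounds(1) n by (intro sum_mono) (simp add: f_def divide_right_mono)
    also have "\<dots> = (\<Sum>z\<in>UNIV. f z t)"
      by (rule sum.mono_neutral_left) (auto simp: f_def)
    finally show "L / (2 * n\<^sup>2) * (\<Sum>z\<in>S. \<Sum>z'\<in>S. (sqrt (p z t) - sqrt (p z' t))\<^sup>2)
        \<le> (\<Sum>z\<in>UNIV. f z t)" .
  qed
  finally have "L / (2 * n\<^sup>2) * (\<integral>t. (\<Sum>z\<in>S. \<Sum>z'\<in>S. (sqrt (p z t) - sqrt (p z' t))\<^sup>2) \<partial>count_space UNIV)
      \<le> (\<integral>(z, t). f z t \<partial>count_space UNIV)"
    by simp
  also have "(\<lambda>(z, t). f z t) = (\<lambda>(z, t). pmf (pmf_of_set S) z * pmf (\<pi> z) t *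
      log 2 (pmf (pmf_of_set S) z * pmf (\<pi> z) t / (pmf (pmf_of_set S) z * pmf \<mu> t)))"
    using S n by (auto simp: f_def p_def m_def n_def fun_eq_iff indicator_def)
  finally show ?thesis
    unfolding mutual_information_kernel[OF J meas law] by (simp add: L_def n_def p_def \<mu>_def)
qed

subsection \<open>The lower bound\<close>

lemma integral_pmf_indicator:
  "(\<integral>t. pmf p t * indicator A t \<partial>count_space UNIV) = measure p A"
proof -
  have "measure p A = (\<integral>t. indicator A t \<partial>measure_pmf p)" by simp
  also have "\<dots> = (\<integral>t. pmf p t * indicator A t \<partial>count_space UNIV)"
    unfolding measure_pmf_eq_density by (subst integral_density) simp_all
  finally show ?thesis by simp
qed

text \<open>The bound is the affinity of the two-point laws with masses
  \<open>1 - \<delta>, \<delta>\<close> and \<open>\<delta>, 1 - \<delta>\<close>. It follows from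
  weighted arithmetic and geometric means, with \<open>c\<close> on the mass of \<open>p\<close>
  inside \<open>A\<close> and \<open>1 / c\<close> outside. The condition \<open>c \<le> 1\<close>
  makes the estimate decrease in the gap between the two probabilities of \<open>A\<close>.\<close>

lemma bhattacharyya_le:
  fixes p q :: "'b pmf"
  assumes p: "1 - \<delta> \<le> measure p A" and q: "measure q A \<le> \<delta>"
    and \<delta>: "0 \<le> \<delta>" "\<delta> \<le> 1/2"
  shows "(\<integral>t. sqrt (pmf p t * pmf q t) \<partial>count_space UNIV) \<le> 2 * sqrt (\<delta> * (1 - \<delta>))"
proof -
  let ?B = "\<integral>t. sqrt (pmf p t * pmf q t) \<partial>count_space UNIV"
  have int: "integrable (count_space UNIV) (\<lambda>t. pmf r t * indicator X t)" for r :: "'b pmf" and X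
    by (rule integrable_real_mult_indicator) (auto intro: integrable_pmf)
  have B: "?B \<le> c * (1 - \<delta>) + \<delta> / c" if c: "0 < c" "c \<le> 1" for c
  proof -
    have "?B \<le> (\<integral>t. (c * (pmf p t * indicator A t) + (pmf q t * indicator A t) / c
        + (pmf p t * indicator (- A) t) / c + c * (pmf q t * indicator (- A) t)) / 2 \<partial>count_space UNIV)"
    proof (rule integral_mono[OF integrable_sqrt_mult_pmf])
      show "integrable (count_space UNIV) (\<lambda>t. (c * (pmf p t * indicator A t)
          + (pmf q t * indicator A t) / c + (pmf p t * indicator (- A) t) / c
          + c * (pmf q t * indicator (- A) t)) / 2)"
        by (intro integrable_divide Bochner_Integration.integrable_add integrable_mult_right int)
      fix t
      show "sqrt (pmf p t * pmf q t) \<le> (c * (pmf p t * indicator A t) + (pmf q t * indicator A t) / c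
          + (pmf p t * indicator (- A) t) / c + c * (pmf q t * indicator (- A) t)) / 2"
        using arith_geo_mean_sqrt[of "c * pmf p t" "pmf q t / c"]
          arith_geo_mean_sqrt[of "pmf p t / c" "c * pmf q t"] c
        by (simp add: indicator_def)
    qed
    also have "\<dots> = (c * measure p A + measure q A / c + measure p (- A) / c + c * measure q (- A)) / 2"
      by (simp add: integral_pmf_indicator int)
    also have "\<dots> = (c + 1 / c - (1 / c - c) * (measure p A - measure q A)) / 2"
    proof -
      have compl: "measure r (- A) = 1 - measure r A" for r :: "'b pmf"
        using measure_pmf.prob_compl[of A r] by (simp add: Compl_eq_Diff_UNIV)
      then show ?thesis unfolding compl using c by (simp add: field_simps)
    qed
    also have "\<dots> \<le> (c + 1 / c - (1 / c - c) * (1 - \<delta> - \<delta>)) / 2"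
    proof -
      have "0 \<le> 1 / c - c" using c mult_le_one[of c c] by (simp add: field_simps)
      then have "(1 / c - c) * (1 - \<delta> - \<delta>) \<le> (1 / c - c) * (measure p A - measure q A)"
        using p q by (intro mult_left_mono) auto
      then show ?thesis by simp
    qed
    also have "\<dots> = c * (1 - \<delta>) + \<delta> / c" using c by (simp add: field_simps)
    finally show ?thesis .
  qed
  show ?thesis
  proof (cases "\<delta> = 0")
    case True
    \<comment> \<open>The optimal weight would be \<open>c = 0\<close>, so the limit of small
      \<open>c\<close> is taken instead.\<close>
    have "?B \<le> 0"
    proof (rule field_le_epsilon)
      fix e :: real assume "0 < e"
      then show "?B \<le> 0 + e" using B[of "min e 1"] True by simp
    qed
    then show ?thesis using True by simp
  next
    case False
    \<comment> \<open>The minimizer of \<open>c * (1 - \<delta>) + \<delta> / c\<close>; it is at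
      most 1 because \<open>\<delta> \<le> 1/2\<close>.\<close>
    define c where "c = sqrt \<delta> / sqrt (1 - \<delta>)"
    have s: "0 < sqrt \<delta>" "0 < sqrt (1 - \<delta>)" "sqrt \<delta> * sqrt \<delta> = \<delta>"
      "sqrt (1 - \<delta>) * sqrt (1 - \<delta>) = 1 - \<delta>"
      using False \<delta> by simp_all
    have "c * (1 - \<delta>) = sqrt \<delta> * sqrt (1 - \<delta>)"
      unfolding c_def using s by (metis nonzero_mult_div_cancel_right mult.assoc times_divide_eq_left less_irrefl)
    moreover have "\<delta> / c = sqrt \<delta> * sqrt (1 - \<delta>)"
      unfolding c_def using s by (simp add: field_simps)
    moreover have "0 < c" "c \<le> 1" using s \<delta> by (simp_all add: c_def)
    ultimately show ?thesis using B[of c] by (simp add: real_sqrt_mult)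
  qed
qed

lemma sqrt_prod: "sqrt (\<Prod>i\<in>A. f i) = (\<Prod>i\<in>A. sqrt (f i))"
  by (induction A rule: infinite_finite_induct) (simp_all add: real_sqrt_mult)

text \<open>Integrates the pointwise inequality over transcripts. The event that the answer is true
  separates the laws at all-ones and all-zeros, so their affinity is small.\<close>

lemma energy_transcript_law_ge:
  fixes P :: "('k::finite, bool) protocol"
  assumes P: "nof_protocol P" and err: "computes_with_error P \<delta> AND_fun"
    and \<delta>: "0 \<le> \<delta>" "\<delta> \<le> 1/2"
  shows "1 - 2 * sqrt (\<delta> * (1 - \<delta>))
    \<le> (\<integral>t. energy (\<lambda>z. sqrt (pmf (transcript_law P z) t)) \<partial>count_space UNIV)"
proof -
  define p where "p = (\<lambda>z. pmf (transcript_law P z))"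
  define T F :: "'k \<Rightarrow> bool" where "T = (\<lambda>_. True)" and "F = (\<lambda>_. False)"
  interpret J: prob_space "joint_coins :: ('k \<Rightarrow> coins) measure" by (rule prob_space_joint_coins)
  have int_p: "integrable (count_space UNIV) (p z)" for z by (simp add: p_def integrable_pmf)
  have int_sqrt: "integrable (count_space UNIV) (\<lambda>t. sqrt (p T t * p F t))"
    unfolding p_def by (rule integrable_sqrt_mult_pmf)
  have "(\<integral>t. sqrt (p T t * p F t) \<partial>count_space UNIV) \<le> 2 * sqrt (\<delta> * (1 - \<delta>))"
    unfolding p_def
  proof (rule bhattacharyya_le[OF _ _ \<delta>])
    show "1 - \<delta> \<le> measure (transcript_law P T) {t. answer P t}"
      using err[unfolded computes_with_error_def, rule_format, of T]
      by (simp add: measure_transcript_law[OF P] AND_fun_def T_def)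
    have "1 - \<delta> \<le> measure (transcript_law P F) (- {t. answer P t})"
      using err[unfolded computes_with_error_def, rule_format, of F]
      by (simp add: measure_transcript_law[OF P] AND_fun_def F_def)
    then show "measure (transcript_law P F) {t. answer P t} \<le> \<delta>"
      using measure_pmf.prob_compl[of "{t. answer P t}" "transcript_law P F"]
      by (simp add: Compl_eq_Diff_UNIV)
  qed
  then have "2 * (1 - 2 * sqrt (\<delta> * (1 - \<delta>))) \<le> 2 - 2 * (\<integral>t. sqrt (p T t * p F t) \<partial>count_space UNIV)"
    by simp
  \<comment> \<open>Each law has total mass 1 and the parity classes have equal size, so the signed
    sum integrates to 0.\<close>
  also have "\<dots> = (\<integral>t. p T t + p F t - 2 * sqrt (p T t * p F t)
      + (\<Sum>z\<in>odd_zeros. p z t) - (\<Sum>z\<in>- odd_zeros. p z t) \<partial>count_space UNIV)"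
  proof -
    have "(\<integral>t. p z t \<partial>count_space UNIV) = 1" for z by (simp add: p_def integral_pmf)
    then show ?thesis
      using card_odd_zeros[where 'k = 'k] by (simp add: int_p int_sqrt Bochner_Integration.integral_sum)
  qed
  also have "\<dots> \<le> (\<integral>t. 2 * energy (\<lambda>z. sqrt (p z t)) \<partial>count_space UNIV)"
  proof (rule integral_mono)
    show "integrable (count_space UNIV) (\<lambda>t. p T t + p F t - 2 * sqrt (p T t * p F t)
        + (\<Sum>z\<in>odd_zeros. p z t) - (\<Sum>z\<in>- odd_zeros. p z t))"
      by (intro Bochner_Integration.integrable_add Bochner_Integration.integrable_diff
          integrable_mult_right Bochner_Integration.integrable_sum int_p int_sqrt)
    show "integrable (count_space UNIV) (\<lambda>t. 2 * energy (\<lambda>z. sqrt (p z t)))"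
      unfolding energy_def p_def
      by (intro integrable_mult_right Bochner_Integration.integrable_sum integrable_sqrt_diff_pmf)
    fix t
    have nonneg: "0 \<le> p z t" for z by (simp add: p_def)
    have "(\<Prod>z\<in>odd_zeros. sqrt (p z t)) = (\<Prod>z\<in>- odd_zeros. sqrt (p z t))"
      using transcript_law_cut_and_paste[OF P, of t] by (simp add: p_def flip: sqrt_prod)
    from cut_and_paste[OF _ this] nonneg
    show "p T t + p F t - 2 * sqrt (p T t * p F t)
        + (\<Sum>z\<in>odd_zeros. p z t) - (\<Sum>z\<in>- odd_zeros. p z t) \<le> 2 * energy (\<lambda>z. sqrt (p z t))"
      by (simp add: T_def F_def power2_diff real_sqrt_mult)
  qed
  finally show ?thesis by (simp add: p_def)
qed

lemma information_cost_zeta_ge: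
  fixes P :: "('k::finite, bool) protocol"
  assumes P: "nof_protocol P"
  shows "log 2 (exp 1) / (2 * 4 ^ (CARD('k) - 1)) *
      (\<integral>t. (\<Sum>z | \<not> z j. \<Sum>z' | \<not> z' j.
        (sqrt (pmf (transcript_law P z) t) - sqrt (pmf (transcript_law P z') t))\<^sup>2) \<partial>count_space UNIV)
    \<le> information_cost (zeta j) P"
proof -
  \<comment> \<open>This is the squared size of the support of \<open>zeta j\<close>.\<close>
  have "(real (2 ^ (CARD('k) - 1)))\<^sup>2 = 4 ^ (CARD('k) - 1)"
    by (simp add: power2_eq_square flip: power_mult_distrib)
  moreover have "{z :: 'k \<Rightarrow> bool. \<not> z j} \<noteq> {}" by auto
  ultimately show ?thesis
    using uniform_mutual_information_ge[OF _ prob_space_joint_coins measurable_transcript[OF P]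
        measure_pmf_transcript_law[OF P], of "{z. \<not> z j}"]
    by (simp add: information_cost_def zeta_def card_coordinate_False)
qed

lemma sum_information_cost_ge:
  fixes P :: "('k::finite, bool) protocol"
  assumes P: "nof_protocol P" and err: "computes_with_error P \<delta> AND_fun"
    and \<delta>: "0 \<le> \<delta>" "\<delta> \<le> 1/2"
  shows "log 2 (exp 1) / (2 * 4 ^ (CARD('k) - 1)) * (1 - 2 * sqrt (\<delta> * (1 - \<delta>)))
    \<le> (\<Sum>j\<in>UNIV. information_cost (zeta j) P)"
proof -
  let ?x = "\<lambda>t z. sqrt (pmf (transcript_law P z) t)"
  let ?c = "log 2 (exp 1) / (2 * 4 ^ (CARD('k) - 1))"
  have "?c * (1 - 2 * sqrt (\<delta> * (1 - \<delta>))) \<le> ?c * (\<integral>t. energy (?x t) \<partial>count_space UNIV)"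
    by (intro mult_left_mono energy_transcript_law_ge[OF P err \<delta>]) simp
  also have "(\<integral>t. energy (?x t) \<partial>count_space UNIV)
      = (\<Sum>j\<in>UNIV. \<integral>t. (\<Sum>z | \<not> z j. \<Sum>z' | \<not> z' j. (?x t z - ?x t z')\<^sup>2) \<partial>count_space UNIV)"
    unfolding energy_def
    by (intro Bochner_Integration.integral_sum Bochner_Integration.integrable_sum integrable_sqrt_diff_pmf)
  also have "?c * \<dots> \<le> (\<Sum>j\<in>UNIV. information_cost (zeta j) P)"
    unfolding sum_distrib_left by (intro sum_mono information_cost_zeta_ge[OF P])
  finally show ?thesis .
qed

text \<open>The infimum of an empty set of reals would carry no information. Two players suffice:
  \<open>a\<close> announces the conjunction of all other bits, and \<open>b\<close> announces the
  bit of \<open>a\<close>.\<close>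

lemma AND_protocol_exists:
  fixes \<delta> :: real
  assumes "CARD('k::finite) \<ge> 2" "0 \<le> \<delta>"
  shows "\<exists>P :: ('k, bool) protocol. nof_protocol P \<and> computes_with_error P \<delta> AND_fun"
proof -
  obtain a b :: 'k where ab: "a \<noteq> b"
    using assms(1) by (metis card_2_iff' card_le_Suc_iff ex_card UNIV_I)
  define P :: "('k, bool) protocol" where
    "P = \<lparr>speaker = (\<lambda>t. if length t = 0 then Some a else if length t = 1 then Some b else None),
          message = (\<lambda>j z t c. if t = [] then \<forall>i. i \<noteq> j \<longrightarrow> z i else j \<noteq> a \<and> z a),
          answer = (\<lambda>t. t ! 0 \<and> t ! 1)\<rparr>"
  have run: "run P z r 0 = []" "run P z r (Suc 0) = [\<forall>i. i \<noteq> a \<longrightarrow> z i]"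
    "run P z r (Suc (Suc 0)) = [\<forall>i. i \<noteq> a \<longrightarrow> z i, z a]" for z r
    using ab by (simp_all add: P_def)
  have "(LEAST n. speaker P (run P z r n) = None) = Suc (Suc 0)" for z r
  proof (rule Least_equality)
    show "speaker P (run P z r (Suc (Suc 0))) = None" unfolding run by (simp add: P_def)
    fix n assume n: "speaker P (run P z r n) = None"
    show "Suc (Suc 0) \<le> n"
    proof (rule ccontr)
      assume "\<not> Suc (Suc 0) \<le> n"
      then consider "n = 0" | "n = Suc 0" by linarith
      then show False using n by cases (simp_all only: run, simp_all add: P_def)
    qed
  qed
  then have transcript: "transcript P z r = [\<forall>i. i \<noteq> a \<longrightarrow> z i, z a]" for z r
    by (simp only: transcript_def run)
  interpret J: prob_space "joint_coins :: ('k \<Rightarrow> coins) measure" by (rule prob_space_joint_coins)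
  have "halts P z r" for z r
    unfolding halts_def by (rule exI[of _ "Suc (Suc 0)"], unfold run) (simp add: P_def)
  then have "nof_protocol P"
    unfolding nof_protocol_def by (auto simp: P_def)
  moreover have "answer P (transcript P z r) = AND_fun z" for z r
    unfolding transcript by (auto simp: P_def AND_fun_def)
  then have "computes_with_error P \<delta> AND_fun"
    using J.prob_space assms(2) by (simp add: computes_with_error_def)
  ultimately show ?thesis by blast
qed

theorem theorem5p1:
  fixes \<delta> :: real
  assumes "CARD('k::finite) \<ge> 2"
    and "0 \<le> \<delta>" and "\<delta> \<le> 1/2"
  shows "IC (zeta :: 'k \<Rightarrow> ('k \<Rightarrow> bool) pmf) \<delta> AND_fun
           \<ge> log 2 (exp 1) * (1 - 2 * sqrt (\<delta> * (1 - \<delta>)))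
               * (1 / (real CARD('k) ^ 2 * 4 ^ (CARD('k) - 1)))"
  unfolding IC_def
proof (rule cINF_greatest)
  show "{P :: ('k, bool) protocol. nof_protocol P \<and> computes_with_error P \<delta> AND_fun} \<noteq> {}"
    using AND_protocol_exists[where 'k = 'k, OF assms(1,2)] by blast
next
  fix P :: "('k, bool) protocol"
  assume "P \<in> {P. nof_protocol P \<and> computes_with_error P \<delta> AND_fun}"
  then have P: "nof_protocol P" "computes_with_error P \<delta> AND_fun" by auto
  define k where "k = real CARD('k)"
  define c where "c = log 2 (exp 1) * (1 - 2 * sqrt (\<delta> * (1 - \<delta>))) / 4 ^ (CARD('k) - 1)"
  have k: "2 \<le> k" using assms(1) by (simp add: k_def)
  have "sqrt (\<delta> * (1 - \<delta>)) \<le> 1 / 2"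
    using arith_geo_mean_sqrt[of \<delta> "1 - \<delta>"] assms by simp
  then have c: "0 \<le> c" by (simp add: c_def)
  \<comment> \<open>The argument yields \<open>c / (2 * k)\<close>, which dominates the claimed
    \<open>c / k\<^sup>2\<close> because \<open>2 \<le> k\<close> and
    \<open>0 \<le> c\<close>.\<close>
  have "c / k\<^sup>2 \<le> c / (2 * k)"
    using c k by (intro divide_left_mono) (auto simp: power2_eq_square)
  also have "\<dots> = 1 / k * (c / 2)" by simp
  also have "\<dots> \<le> 1 / k * (\<Sum>j\<in>UNIV. information_cost (zeta j) P)"
    using sum_information_cost_ge[OF P assms(2,3)] k by (intro mult_left_mono) (simp_all add: c_def mult.commute)
  finally show "log 2 (exp 1) * (1 - 2 * sqrt (\<delta> * (1 - \<delta>)))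
      * (1 / (real CARD('k) ^ 2 * 4 ^ (CARD('k) - 1)))
    \<le> 1 / real CARD('k) * (\<Sum>j\<in>UNIV. information_cost (zeta j) P)"
    by (simp add: c_def k_def field_simps)
qed

end
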